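(* Let $u\in C^2(\Omega)\cap Lip(\Omega,M)$, let $A>0$, $I=[0,A]$, and let $x^0\in\Omega$. Consider gradient descent with exact line search, $$x^{k+1}=x^k-\alpha^k\nabla u(x^k),\qquad \alpha^k=\arg\min_{\alpha\in I}u\big(x^k-\alpha\nabla u(x^k)\big),$$ and, for each $n\in\mathbb{N}$, nonlocal gradient descent with exact line search, initialized with $x^{0,n}=x^0$, $$x^{k+1,n}=x^{k,n}-\alpha^{k,n}\nabla_n u(x^{k,n}),\qquad \alpha^{k,n}=\arg\min_{\alpha\in I}u\big(x^{k,n}-\alpha\nabla_n u(x^{k,n})\big).$$ Assume that $A$ is such that all the points $x^k-\alpha\nabla u(x^k)$ and $x^{k,n}-\alpha\nabla_n u(x^{k,n})$, $\alpha\in I$, lie in $\Omega$, and that the line-search minimizers $\alpha^k$ and $\alpha^{k,n}$ are unique. Then, for each $k$, there exists a subsequence $\{\alpha^{k,n_{m_1}(k)}\}$ of $\{\alpha^{k,n}\}_{n=1}^\infty$ such that $\alpha^{k,n_{m_1}(k)}\to\alpha^k$ as $n_{m_1}(k)\to\infty$, and a subsequence $\{x^{k,n_{m_2}(k)}\}$ of $\{x^{k,n}\}_{n=1}^\infty$ such that $x^{k,n_{m_2}(k)}\to x^k$ as $n_{m_2}(k)\to\infty$.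
   Context: $\Omega\subset\mathbb{R}^D$ is a bounded, connected, simply connected open set with smooth compact boundary. $\|\cdot\|$ is the Euclidean norm. $Lip(\Omega,M)$ is the set of functions $u:\Omega\to\mathbb{R}$ that are Lipschitz with constant $M$; $C^2(\Omega)$ is the set of twice continuously differentiable functions on $\Omega$. Fix a sequence of radial functions $\rho_n:\mathbb{R}^D\to\mathbb{R}$, $n=1,2,\ldots$ (i.e. $\rho_n(x)=\hat\rho_n(\|x\|)$ for some function $\hat\rho_n$) with $\rho_n\ge 0$, $\int_{\mathbb{R}^D}\rho_n(x)\,dx=1$, and $\lim_{n\to\infty}\int_{\|x\|>\delta}\rho_n(x)\,dx=0$ for all $\delta>0$. The nonlocal gradient at scale $n$ is $$\nabla_n u(x)=D\int_\Omega \frac{u(x)-u(y)}{\|x-y\|}\,\frac{x-y}{\|x-y\|}\,\rho_n(x-y)\,dy ,$$ which converges absolutely for Lipschitz $u$. *)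

theory Defs
  imports "HOL-Analysis.Analysis"
begin

text \<open>Meant for open \<open>S\<close>: derivatives are taken at the full neighbourhood filter of each point.
  In the step, \<open>frechet_derivative f (at x) i\<close> is the partial derivative of \<open>f\<close> in direction \<open>i\<close>.\<close>

primrec Ck_on :: "nat \<Rightarrow> ('a::euclidean_space \<Rightarrow> real) \<Rightarrow> 'a set \<Rightarrow> bool" where
  "Ck_on 0 f S \<longleftrightarrow> continuous_on S f"
| "Ck_on (Suc k) f S \<longleftrightarrow> (\<forall>x\<in>S. f differentiable (at x)) \<and>
     (\<forall>i\<in>Basis. Ck_on k (\<lambda>x. frechet_derivative f (at x) i) S)"

definition gradient :: "('a::euclidean_space \<Rightarrow> real) \<Rightarrow> 'a \<Rightarrow> 'a" where
  "gradient f x = (THE d. GDERIV f x :> d)"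

text \<open>Near every boundary point, \<open>\<Omega>\<close> is a strict sublevel set of a smooth function with
  non-vanishing gradient (so the boundary is locally a smooth hypersurface, with \<open>\<Omega>\<close> on one side).
  For open \<open>\<Omega>\<close> the defining function automatically vanishes at the boundary points in \<open>U\<close>.\<close>

definition smooth_boundary :: "'a::euclidean_space set \<Rightarrow> bool" where
  "smooth_boundary \<Omega> \<longleftrightarrow> (\<forall>p\<in>frontier \<Omega>. \<exists>U \<phi>. open U \<and> p \<in> U \<and> (\<forall>k. Ck_on k \<phi> U) \<and>
     (\<forall>x\<in>U. gradient \<phi> x \<noteq> 0) \<and> \<Omega> \<inter> U = {x \<in> U. \<phi> x < 0})"

text \<open>The sequences are indexed by \<open>n \<ge> 1\<close>; the value \<open>\<rho> 0\<close> is irrelevant.\<close>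

definition radial_mollifiers :: "(nat \<Rightarrow> 'a::euclidean_space \<Rightarrow> real) \<Rightarrow> bool" where
  "radial_mollifiers \<rho> \<longleftrightarrow>
     (\<forall>n\<ge>1. (\<exists>h. \<forall>x. \<rho> n x = h (norm x)) \<and> (\<forall>x. 0 \<le> \<rho> n x) \<and>
        has_bochner_integral lebesgue (\<rho> n) 1) \<and>
     (\<forall>\<delta>>0. (\<lambda>n. LINT x:{x. norm x > \<delta>}|lebesgue. \<rho> n x) \<longlonglongrightarrow> 0)"

text \<open>At \<open>y = x\<close> the integrand is \<open>0\<close> by the convention \<open>1 / 0 = 0\<close>; this is a null set.\<close>

definition nonlocal_gradient ::
  "'a::euclidean_space set \<Rightarrow> ('a \<Rightarrow> real) \<Rightarrow> ('a \<Rightarrow> real) \<Rightarrow> 'a \<Rightarrow> 'a" where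
  "nonlocal_gradient \<Omega> r u x = real DIM('a) *\<^sub>R
     (LINT y:\<Omega>|lebesgue.
        ((u x - u y) / norm (x - y) * r (x - y)) *\<^sub>R ((x - y) /\<^sub>R norm (x - y)))"

text \<open>Descent along the field \<open>G\<close> with exact line search over \<open>{0..A}\<close>. Uniqueness of the
  minimizers is not built in; without it, \<open>arg_min_on\<close> selects an arbitrary one.\<close>

definition exact_line_search_descent ::
  "('a::euclidean_space \<Rightarrow> real) \<Rightarrow> real \<Rightarrow> ('a \<Rightarrow> 'a) \<Rightarrow> 'a \<Rightarrow> (nat \<Rightarrow> 'a) \<Rightarrow> (nat \<Rightarrow> real) \<Rightarrow> bool" where
  "exact_line_search_descent u A G x0 x \<alpha> \<longleftrightarrow> x 0 = x0 \<and>
     (\<forall>k. \<alpha> k = arg_min_on (\<lambda>t. u (x k - t *\<^sub>R G (x k))) {0..A} \<and>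
          x (Suc k) = x k - \<alpha> k *\<^sub>R G (x k))"

definition unique_line_minimizer ::
  "('a::euclidean_space \<Rightarrow> real) \<Rightarrow> real \<Rightarrow> ('a \<Rightarrow> 'a) \<Rightarrow> 'a \<Rightarrow> bool" where
  "unique_line_minimizer u A G y \<longleftrightarrow>
     (\<exists>!t. is_arg_min (\<lambda>t. u (y - t *\<^sub>R G y)) (\<lambda>t. t \<in> {0..A}) t)"

end

theory Submission
  imports Defs
begin

text \<open>The whole sequences converge, by induction on \<open>k\<close>.
  The key point is that \<open>y\<^sub>n \<longlonglongrightarrow> y\<close> in \<open>\<Omega>\<close> implies that the nonlocal gradients at \<open>y\<^sub>n\<close>
  converge to \<open>\<nabla>u(y)\<close>. By radial symmetry, the nonlocal operator over the whole space
  reproduces the gradient of a linear function exactly; near \<open>y\<close> the function \<open>u\<close> is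
  linear up to \<open>\<epsilon>\<parallel>x - y\<parallel>\<close>, uniformly in the base point, and far away the Lipschitz bound is
  multiplied by the vanishing tail mass of \<open>\<rho>\<^sub>n\<close>. The line-search functions then converge
  continuously on \<open>[0,A]\<close>, so every cluster point of their minimizers is the unique minimizer
  of the limit.\<close>

section \<open>Maps preserving Lebesgue measure\<close>

text \<open>\<open>lebesgue\<close> is the completion of \<open>lborel\<close>. Since
  \<open>T\<close> pushes \<open>lborel\<close> forward to itself, preimages of null sets are null,
  so measurability and invariance pass to the completion.\<close>

lemma
  fixes T :: "'a::euclidean_space \<Rightarrow> 'a"
  assumes T: "T \<in> borel_measurable borel" and eq: "distr lborel borel T = lborel"
  shows measurable_lebesgue_of_lborel_distr: "T \<in> lebesgue \<rightarrow>\<^sub>M lebesgue"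
    and lebesgue_distr_of_lborel_distr: "distr lebesgue lebesgue T = lebesgue"
proof -
  have d: "distr lebesgue lborel T = lborel"
    using T eq by (simp add: distr_completion cong: distr_cong)
  have T': "T \<in> lebesgue \<rightarrow>\<^sub>M lborel"
    using T by (auto intro: measurable_completion)
  show "T \<in> lebesgue \<rightarrow>\<^sub>M lebesgue"
    by (rule completion.measurable_completion2[OF T']) (simp add: d)
  show "distr lebesgue lebesgue T = lebesgue"
    using completion.completion_distr_eq[OF T'] by (simp add: d)
qed

text \<open>Exchanges the coordinates along two basis vectors. The coordinatewise form makes
  preimages of boxes visibly boxes.\<close>

definition basis_swap :: "'a \<Rightarrow> 'a \<Rightarrow> 'a \<Rightarrow> 'a::euclidean_space" where
  "basis_swap i j x = (\<Sum>b\<in>Basis. (x \<bullet> Transposition.transpose i j b) *\<^sub>R b)"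

context
  fixes i j :: "'a::euclidean_space"
  assumes i: "i \<in> Basis" and j: "j \<in> Basis"
begin

lemma bij_betw_transpose_Basis: "bij_betw (Transposition.transpose i j) Basis Basis"
  using i j by (intro bij_betwI[of _ _ _ "Transposition.transpose i j"]) (auto simp: Transposition.transpose_def)

lemma basis_swap_inner: "b \<in> Basis \<Longrightarrow> basis_swap i j x \<bullet> b = x \<bullet> Transposition.transpose i j b"
  by (simp add: basis_swap_def inner_sum_left inner_Basis if_distrib cong: if_cong)

lemma norm_basis_swap: "norm (basis_swap i j x) = norm x"
proof -
  have "(\<Sum>b\<in>Basis. (basis_swap i j x \<bullet> b) * (basis_swap i j x \<bullet> b))
      = (\<Sum>b\<in>Basis. (x \<bullet> Transposition.transpose i j b) * (x \<bullet> Transposition.transpose i j b))"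
    by (simp add: basis_swap_inner)
  also have "\<dots> = (\<Sum>b\<in>Basis. (x \<bullet> b) * (x \<bullet> b))"
    by (rule sum.reindex_bij_betw[OF bij_betw_transpose_Basis])
  finally show ?thesis
    by (simp add: norm_eq_sqrt_inner euclidean_inner[of x x]
        euclidean_inner[of "basis_swap i j x" "basis_swap i j x"])
qed

lemma borel_measurable_basis_swap: "basis_swap i j \<in> borel_measurable borel"
  unfolding basis_swap_def by measurable

text \<open>A measure giving every box its volume is \<open>lborel\<close>. The map is an
  involution, so the preimage of a box is the box with swapped corners, whose edge lengths are only
  permuted.\<close>

lemma lborel_distr_basis_swap: "distr lborel borel (basis_swap i j) = (lborel :: 'a measure)"
proof (rule lborel_eqI[symmetric])
  fix l u :: 'a
  assume lu: "\<And>b. b \<in> Basis \<Longrightarrow> l \<bullet> b \<le> u \<bullet> b"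
  have tB: "Transposition.transpose i j b \<in> Basis" if "b \<in> Basis" for b
    using that bij_betw_transpose_Basis by (auto simp: bij_betw_def)
  have "basis_swap i j -` box l u = box (basis_swap i j l) (basis_swap i j u)"
  proof (intro set_eqI iffI)
    fix x assume x: "x \<in> basis_swap i j -` box l u"
    show "x \<in> box (basis_swap i j l) (basis_swap i j u)"
    proof (clarsimp simp: mem_box)
      fix b :: 'a assume b: "b \<in> Basis"
      show "basis_swap i j l \<bullet> b < x \<bullet> b \<and> x \<bullet> b < basis_swap i j u \<bullet> b"
        using x b tB[OF b] by (force simp: mem_box basis_swap_inner)
    qed
  next
    fix x assume x: "x \<in> box (basis_swap i j l) (basis_swap i j u)"
    show "x \<in> basis_swap i j -` box l u"
    proof (clarsimp simp: mem_box)
      fix b :: 'a assume b: "b \<in> Basis"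
      show "l \<bullet> b < basis_swap i j x \<bullet> b \<and> basis_swap i j x \<bullet> b < u \<bullet> b"
        using x b tB[OF b] by (force simp: mem_box basis_swap_inner)
    qed
  qed
  then have "emeasure (distr lborel borel (basis_swap i j)) (box l u)
      = emeasure lborel (box (basis_swap i j l) (basis_swap i j u))"
    using borel_measurable_basis_swap by (simp add: emeasure_distr)
  also have "\<dots> = (\<Prod>b\<in>Basis. (u - l) \<bullet> Transposition.transpose i j b)"
    using lu tB by (subst emeasure_lborel_box) (auto simp: basis_swap_inner inner_diff_left)
  also have "\<dots> = (\<Prod>b\<in>Basis. (u - l) \<bullet> b)"
    by (subst prod.reindex_bij_betw[OF bij_betw_transpose_Basis]) simp
  finally show "emeasure (distr lborel borel (basis_swap i j)) (box l u)
      = (\<Prod>b\<in>Basis. (u - l) \<bullet> b)" .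
qed simp

lemmas measurable_basis_swap_lebesgue =
  measurable_lebesgue_of_lborel_distr[OF borel_measurable_basis_swap lborel_distr_basis_swap]
lemmas lebesgue_distr_basis_swap =
  lebesgue_distr_of_lborel_distr[OF borel_measurable_basis_swap lborel_distr_basis_swap]

end

text \<open>Change of variables for a diagonal affine map brings in the product of the
  \<open>\<bar>c j\<bar>\<close>, which is 1 here. This covers both the flip of a single coordinate
  and point reflections.\<close>

lemma
  fixes c :: "'a::euclidean_space \<Rightarrow> real" and t :: 'a
  assumes c: "\<And>j. j \<in> Basis \<Longrightarrow> \<bar>c j\<bar> = 1"
  defines "T \<equiv> \<lambda>x. t + (\<Sum>j\<in>Basis. (c j * (x \<bullet> j)) *\<^sub>R j)"
  shows measurable_lebesgue_sign_change: "T \<in> lebesgue \<rightarrow>\<^sub>M lebesgue"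
    and lebesgue_distr_sign_change: "distr lebesgue lebesgue T = lebesgue"
proof -
  have nz: "\<And>j. j \<in> Basis \<Longrightarrow> c j \<noteq> 0" using c by fastforce
  show "T \<in> lebesgue \<rightarrow>\<^sub>M lebesgue"
    unfolding T_def by (rule lebesgue_affine_measurable[OF nz])
  have "lebesgue = density (distr lebesgue lebesgue T) (\<lambda>_. (\<Prod>j\<in>Basis. \<bar>c j\<bar>))"
    unfolding T_def by (rule lebesgue_affine_euclidean[OF nz])
  then show "distr lebesgue lebesgue T = lebesgue"
    using c by (simp add: density_1)
qed

text \<open>Serves the substitution \<open>w = x - y\<close>, which moves the centre of the kernel
  to the origin.\<close>

lemma
  fixes x :: "'a::euclidean_space"
  shows measurable_lebesgue_reflect: "(\<lambda>y. x - y) \<in> lebesgue \<rightarrow>\<^sub>M lebesgue"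
    and lebesgue_distr_reflect: "distr lebesgue lebesgue (\<lambda>y. x - y) = lebesgue"
proof -
  have "(\<lambda>y. x - y) = (\<lambda>y. x + (\<Sum>j\<in>Basis. (- 1 * (y \<bullet> j)) *\<^sub>R j))"
    by (simp add: sum_negf euclidean_representation)
  then show "(\<lambda>y. x - y) \<in> lebesgue \<rightarrow>\<^sub>M lebesgue" "distr lebesgue lebesgue (\<lambda>y. x - y) = lebesgue"
    using measurable_lebesgue_sign_change[of "\<lambda>_. - 1" x]
      lebesgue_distr_sign_change[of "\<lambda>_. - 1" x] by simp_all
qed

lemma lebesgue_integral_invariant:
  fixes f :: "'a::euclidean_space \<Rightarrow> 'b::{banach, second_countable_topology}"
  assumes "T \<in> lebesgue \<rightarrow>\<^sub>M lebesgue" "distr lebesgue lebesgue T = lebesgue"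
    "f \<in> borel_measurable lebesgue"
  shows "(LINT y|lebesgue. f (T y)) = (LINT y|lebesgue. f y)"
  using integral_distr[OF assms(1,3)] assms(2) by simp

section \<open>Second moments of a radial density\<close>

text \<open>The integrand is built from products of coordinates of the unit vector
  \<open>w /\<^sub>R norm w\<close>, weighted by \<open>r\<close>. By symmetry their matrix of
  integrals is a multiple of the identity, and its trace is \<open>m\<close>. This explains the
  dimension factor in the nonlocal gradient.\<close>

lemma has_bochner_integral_radial_second_moment:
  fixes r :: "'a::euclidean_space \<Rightarrow> real"
  assumes h: "\<And>x. r x = h (norm x)" and r: "has_bochner_integral lebesgue r m"
  shows "has_bochner_integral lebesgue
    (\<lambda>w. ((g \<bullet> w) / norm w * r w) *\<^sub>R (w /\<^sub>R norm w)) ((m / DIM('a)) *\<^sub>R g)"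
proof -
  define q where "q i j w = (w \<bullet> i) * (w \<bullet> j) / (norm w)\<^sup>2 * r w" for i j w :: 'a
  define Q where "Q i j = (LINT w|lebesgue. q i j w)" for i j
  have [measurable]: "r \<in> borel_measurable lebesgue"
    using r by (auto simp: has_bochner_integral_iff)
  have [measurable]: "(\<lambda>x. x) \<in> borel_measurable (lebesgue :: 'a measure)"
    by (simp add: measurable_completion)
  have qm [measurable]: "q i j \<in> borel_measurable lebesgue" for i j
    unfolding q_def by measurable
  have qi: "integrable lebesgue (q i j)" if "i \<in> Basis" "j \<in> Basis" for i j
  proof (rule Bochner_Integration.integrable_bound)
    show "integrable lebesgue r" using r by (simp add: has_bochner_integral_iff)
    show "AE w in lebesgue. norm (q i j w) \<le> norm (r w)"
    proof (intro AE_I2)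
      fix w :: 'a
      have "\<bar>w \<bullet> i\<bar> * \<bar>w \<bullet> j\<bar> \<le> norm w * norm w"
        using that by (intro mult_mono Basis_le_norm) auto
      \<comment> \<open>The bound includes \<open>w = 0\<close>, where the quotient is 0.\<close>
      then have "\<bar>w \<bullet> i\<bar> * \<bar>w \<bullet> j\<bar> / (norm w)\<^sup>2 \<le> 1"
        by (simp add: power2_eq_square divide_le_eq)
      then have "(\<bar>w \<bullet> i\<bar> * \<bar>w \<bullet> j\<bar> / (norm w)\<^sup>2) * \<bar>r w\<bar> \<le> \<bar>r w\<bar>"
        by (intro mult_left_le_one_le) auto
      then show "norm (q i j w) \<le> norm (r w)"
        by (simp add: q_def abs_mult)
    qed
  qed simp
  have off: "Q i j = 0" if "i \<in> Basis" "j \<in> Basis" "i \<noteq> j" for i j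
  proof -
    \<comment> \<open>\<open>?T\<close> flips coordinate \<open>i\<close> only. It preserves the
      norm, hence \<open>r\<close>, and negates \<open>q i j\<close>, so that
      \<open>Q i j = - Q i j\<close>.\<close>
    define c where "c b = (if b = i then - 1 else 1 :: real)" for b
    let ?T = "\<lambda>x. 0 + (\<Sum>b\<in>Basis. (c b * (x \<bullet> b)) *\<^sub>R b)"
    have Tb: "?T x \<bullet> b = c b * (x \<bullet> b)" if "b \<in> Basis" for x b
      using that by (simp add: inner_sum_left inner_Basis if_distrib cong: if_cong)
    have nT: "norm (?T x) = norm x" for x
      unfolding norm_eq_sqrt_inner euclidean_inner[of x x] euclidean_inner[of "?T x" "?T x"]
      by (intro arg_cong[of _ _ sqrt] sum.cong refl) (simp only: Tb, simp add: c_def)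
    have "q i j (?T w) = - q i j w" for w
      unfolding q_def nT h[of "?T w"] h[of w] using that by (simp only: Tb, simp add: c_def)
    moreover have "(LINT w|lebesgue. q i j (?T w)) = Q i j"
      unfolding Q_def
      by (intro lebesgue_integral_invariant measurable_lebesgue_sign_change
          lebesgue_distr_sign_change qm) (auto simp: c_def)
    ultimately show ?thesis by (simp add: Q_def)
  qed
  have diag: "Q i i = Q j j" if "i \<in> Basis" "j \<in> Basis" for i j
  proof -
    have "q i i (basis_swap i j w) = q j j w" for w
      unfolding q_def h[of w] h[of "basis_swap i j w"] norm_basis_swap[OF that]
      using that by (simp add: basis_swap_inner)
    then show ?thesis
      using lebesgue_integral_invariant[OF measurable_basis_swap_lebesgue[OF that]
          lebesgue_distr_basis_swap[OF that] qm, of i i]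
      by (simp add: Q_def)
  qed
  \<comment> \<open>The trace: the squared coordinates of a unit vector add up to 1.\<close>
  have "(\<Sum>i\<in>Basis. Q i i) = (LINT w|lebesgue. (\<Sum>i\<in>Basis. q i i w))"
    unfolding Q_def using qi by (subst Bochner_Integration.integral_sum) auto
  also have "\<dots> = (LINT w|lebesgue. r w)"
  proof (rule integral_cong_AE)
    \<comment> \<open>The origin is left out because the sum is 0 there, whereas \<open>r 0\<close>
      may be positive.\<close>
    have "AE w::'a in lebesgue. w \<noteq> 0"
      by (intro AE_completion AE_lborel_singleton)
    then show "AE w in lebesgue. (\<Sum>i\<in>Basis. q i i w) = r w"
    proof eventually_elim
      case (elim w)
      have "(\<Sum>i\<in>Basis. q i i w) = (\<Sum>i\<in>Basis. (w \<bullet> i) * (w \<bullet> i)) / (norm w)\<^sup>2 * r w"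
        by (simp add: q_def sum_divide_distrib sum_distrib_right)
      also have "\<dots> = r w"
        using elim by (simp add: euclidean_inner[symmetric] power2_norm_eq_inner)
      finally show ?case .
    qed
  qed measurable
  also have "\<dots> = m" using r by (simp add: has_bochner_integral_iff)
  finally have tr: "(\<Sum>i\<in>Basis. Q i i) = m" .
  have Qd: "Q j j = m / DIM('a)" if "j \<in> Basis" for j
  proof -
    have "(\<Sum>i\<in>Basis. Q i i) = (\<Sum>i::'a\<in>Basis. Q j j)"
      by (intro sum.cong refl diag that)
    then show ?thesis using tr by simp
  qed
  \<comment> \<open>Expanding \<open>g \<bullet> w\<close> in the basis writes the integral through
    the \<open>Q i j\<close>, of which only the diagonal ones survive.\<close>
  have "has_bochner_integral lebesgue (\<lambda>w. \<Sum>j\<in>Basis. (\<Sum>i\<in>Basis. (g \<bullet> i) * q i j w) *\<^sub>R j)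
     (\<Sum>j\<in>Basis. (\<Sum>i\<in>Basis. (g \<bullet> i) * Q i j) *\<^sub>R j)"
    using qi by (intro has_bochner_integral_sum has_bochner_integral_scaleR_left
        has_bochner_integral_mult_right) (auto simp: has_bochner_integral_iff Q_def)
  also have "(\<Sum>j\<in>Basis. (\<Sum>i\<in>Basis. (g \<bullet> i) * Q i j) *\<^sub>R j) = (m / DIM('a)) *\<^sub>R g"
  proof -
    have "(\<Sum>i\<in>Basis. (g \<bullet> i) * Q i j) = m / DIM('a) * (g \<bullet> j)" if "j \<in> Basis" for j
    proof -
      have "(\<Sum>i\<in>Basis. (g \<bullet> i) * Q i j) = (\<Sum>i\<in>Basis. if i = j then (g \<bullet> i) * Q i j else 0)"
        using off that by (intro sum.cong) auto
      then show ?thesis using that by (simp add: Qd)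
    qed
    then have "(\<Sum>j\<in>Basis. (\<Sum>i\<in>Basis. (g \<bullet> i) * Q i j) *\<^sub>R j)
        = (m / DIM('a)) *\<^sub>R (\<Sum>j\<in>Basis. (g \<bullet> j) *\<^sub>R j)"
      by (simp add: scaleR_sum_right del: euclidean_representation)
    then show ?thesis by (simp add: euclidean_representation)
  qed
  also have "(\<lambda>w. \<Sum>j\<in>Basis. (\<Sum>i\<in>Basis. (g \<bullet> i) * q i j w) *\<^sub>R j)
      = (\<lambda>w. ((g \<bullet> w) / norm w * r w) *\<^sub>R (w /\<^sub>R norm w))"
  proof
    fix w
    have "(\<Sum>i\<in>Basis. (g \<bullet> i) * q i j w) = (g \<bullet> w) * r w / (norm w)\<^sup>2 * (w \<bullet> j)" for j
      by (simp add: euclidean_inner[of g w] q_def sum_distrib_left sum_distrib_right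
          sum_divide_distrib mult_ac)
    then have "(\<Sum>j\<in>Basis. (\<Sum>i\<in>Basis. (g \<bullet> i) * q i j w) *\<^sub>R j)
      = ((g \<bullet> w) * r w / (norm w)\<^sup>2) *\<^sub>R (\<Sum>j\<in>Basis. (w \<bullet> j) *\<^sub>R j)"
      by (simp add: scaleR_sum_right del: euclidean_representation)
    then show "(\<Sum>j\<in>Basis. (\<Sum>i\<in>Basis. (g \<bullet> i) * q i j w) *\<^sub>R j)
      = ((g \<bullet> w) / norm w * r w) *\<^sub>R (w /\<^sub>R norm w)"
      by (simp add: euclidean_representation power2_eq_square divide_inverse mult_ac)
  qed
  finally show ?thesis .
qed

section \<open>Gradients and uniform linearization\<close>

lemma gradient_eqI:
  assumes "GDERIV f x :> d"
  shows "gradient f x = d"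
  unfolding gradient_def
proof (rule the_equality)
  show "GDERIV f x :> d" by (rule assms)
  fix e assume e: "GDERIV f x :> e"
  have "(\<lambda>h. h \<bullet> e) = (\<lambda>h. h \<bullet> d)"
    using has_derivative_unique[OF e[unfolded gderiv_def] assms[unfolded gderiv_def]] .
  \<comment> \<open>Testing with the difference of the two candidates shows that it has norm
    0.\<close>
  then have "(e - d) \<bullet> e = (e - d) \<bullet> d" by (rule fun_cong)
  then have "(e - d) \<bullet> (e - d) = 0" by (simp add: inner_diff_right)
  then show "e = d" by simp
qed

text \<open>A linear functional is represented by its values on the basis. The formula in partial
  derivatives reduces continuity of the gradient to what \<open>Ck_on\<close> supplies.\<close>

lemma gradient_has_derivative:
  fixes f :: "'a::euclidean_space \<Rightarrow> real"
  assumes "f differentiable (at x)"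
  shows "(f has_derivative (\<lambda>h. h \<bullet> gradient f x)) (at x)"
    and "gradient f x = (\<Sum>i\<in>Basis. frechet_derivative f (at x) i *\<^sub>R i)"
proof -
  let ?D = "frechet_derivative f (at x)"
  let ?g = "\<Sum>i\<in>Basis. ?D i *\<^sub>R i"
  have D: "(f has_derivative ?D) (at x)"
    using assms by (simp add: frechet_derivative_works)
  then have lin: "linear ?D" by (rule has_derivative_linear)
  have "?D h = h \<bullet> ?g" for h
  proof -
    have "?D h = ?D (\<Sum>i\<in>Basis. (h \<bullet> i) *\<^sub>R i)" by (simp add: euclidean_representation)
    also have "\<dots> = h \<bullet> ?g"
      by (simp add: linear_sum[OF lin] linear_scale[OF lin] inner_sum_right mult.commute)
    finally show ?thesis .
  qed
  then have "?D = (\<lambda>h. h \<bullet> ?g)" by blast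
  with D have "GDERIV f x :> ?g" by (simp add: gderiv_def)
  then show "gradient f x = ?g" by (rule gradient_eqI)
  with \<open>GDERIV f x :> ?g\<close> show "(f has_derivative (\<lambda>h. h \<bullet> gradient f x)) (at x)"
    by (simp add: gderiv_def)
qed

lemma Ck_on_continuous_on:
  assumes "Ck_on k f S"
  shows "continuous_on S f"
proof (cases k)
  case (Suc l)
  then show ?thesis using assms
    by (intro continuous_at_imp_continuous_on) (simp add: differentiable_imp_continuous_within)
qed (use assms in simp)

lemma Ck_on_continuous_on_gradient:
  assumes "Ck_on (Suc k) f S"
  shows "continuous_on S (gradient f)"
proof -
  have "continuous_on S (\<lambda>x. \<Sum>i\<in>Basis. frechet_derivative f (at x) i *\<^sub>R i)"
  proof (intro continuous_intros)
    fix i :: 'a assume "i \<in> Basis"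
    then have "Ck_on k (\<lambda>x. frechet_derivative f (at x) i) S" using assms by simp
    then show "continuous_on S (\<lambda>x. frechet_derivative f (at x) i)"
      by (rule Ck_on_continuous_on)
  qed
  then show ?thesis
    using assms by (simp add: gradient_has_derivative(2) cong: continuous_on_cong)
qed

text \<open>Mean value inequality on a ball where the gradient stays within \<open>e\<close> of its
  value at \<open>y\<close>. Both endpoints vary while the linear part is frozen at
  \<open>y\<close>; the moving base points later on require this uniformity.\<close>

lemma C1_linearization:
  fixes f :: "'a::euclidean_space \<Rightarrow> real"
  assumes S: "open S" and f: "Ck_on (Suc k) f S" and y: "y \<in> S" and e: "e > 0"
  obtains d where "d > 0" "ball y d \<subseteq> S"
    "\<And>a b. a \<in> ball y d \<Longrightarrow> b \<in> ball y d \<Longrightarrow>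
      \<bar>f b - f a - (b - a) \<bullet> gradient f y\<bar> \<le> e * norm (b - a)"
proof -
  have "continuous (at y) (gradient f)"
    using Ck_on_continuous_on_gradient[OF f] S y by (simp add: continuous_on_eq_continuous_at)
  then obtain d1 where d1: "d1 > 0"
    "\<And>z. dist z y < d1 \<Longrightarrow> dist (gradient f z) (gradient f y) < e"
    using e unfolding continuous_at_eps_delta by blast
  obtain d2 where d2: "d2 > 0" "ball y d2 \<subseteq> S" using openE[OF S y] .
  let ?B = "ball y (min d1 d2)"
  show ?thesis
  proof (rule that[of "min d1 d2"])
    show "min d1 d2 > 0" "?B \<subseteq> S" using d1 d2 by auto
    fix a b assume a: "a \<in> ?B" and b: "b \<in> ?B"
    have "norm (f b - f a - (b - a) \<bullet> gradient f y) \<le> norm (b - a) * e"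
    proof (rule differentiable_bound_linearization[where a = a and b = b and f = f
          and S = ?B and ?x0.0 = y
          and f' = "\<lambda>z h. h \<bullet> gradient f z"])
      show "a + t *\<^sub>R (b - a) \<in> ?B" if "t \<in> {0..1}" for t
      proof -
        have "(1 - t) *\<^sub>R a + t *\<^sub>R b \<in> ?B"
          using that by (intro convexD_alt[OF convex_ball a b]) auto
        moreover have "(1 - t) *\<^sub>R a + t *\<^sub>R b = a + t *\<^sub>R (b - a)"
          by (simp add: algebra_simps)
        ultimately show ?thesis by (simp only:)
      qed
      show "(f has_derivative (\<lambda>h. h \<bullet> gradient f z)) (at z within ?B)" if "z \<in> ?B" for z
      proof -
        have "z \<in> S" using that d2(2) by auto
        then have "f differentiable (at z)" using f by simp
        then show ?thesis
          by (rule has_derivative_at_withinI[OF gradient_has_derivative(1)])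
      qed
      show "onorm ((\<lambda>h. h \<bullet> gradient f z) - (\<lambda>h. h \<bullet> gradient f y)) \<le> e" if "z \<in> ?B" for z
      proof (rule onorm_le)
        fix h
        have "norm (gradient f z - gradient f y) \<le> e"
          using d1(2)[of z] that by (auto simp: dist_norm norm_minus_commute)
        then have "\<bar>h \<bullet> (gradient f z - gradient f y)\<bar> \<le> e * norm h"
          using Cauchy_Schwarz_ineq2[of h "gradient f z - gradient f y"]
            mult_right_mono[of "norm (gradient f z - gradient f y)" e "norm h"]
          by (simp add: mult.commute)
        then show "norm (((\<lambda>h. h \<bullet> gradient f z) - (\<lambda>h. h \<bullet> gradient f y)) h) \<le> e * norm h"
          by (simp add: inner_diff_right)
      qed
      show "y \<in> ?B" using d1 d2 by simp
    qed
    then show "\<bar>f b - f a - (b - a) \<bullet> gradient f y\<bar> \<le> e * norm (b - a)"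
      by (simp add: mult.commute)
  qed
qed

section \<open>Stability of unique minimizers\<close>

text \<open>Assumption \<open>F\<close> is continuous convergence along subsequences. If
  \<open>t\<close> failed to converge, compactness would give a cluster point other than
  \<open>t0\<close>; the limit of the minimality inequality against each fixed competitor makes it a
  minimizer of \<open>G\<close>, contrary to uniqueness.\<close>

lemma arg_min_tendsto:
  fixes F :: "nat \<Rightarrow> 'a::first_countable_topology \<Rightarrow> real" and K :: "'a set"
  assumes K: "seq_compact K"
    and F: "\<And>s t0 r. (\<And>n. s n \<in> K) \<Longrightarrow> t0 \<in> K \<Longrightarrow> s \<longlonglongrightarrow> t0 \<Longrightarrow> strict_mono r \<Longrightarrow>
      (\<lambda>n. F (r n) (s n)) \<longlonglongrightarrow> G t0"
    and t: "\<And>n. is_arg_min (F n) (\<lambda>t. t \<in> K) (t n)"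
    and uniq: "\<And>t'. is_arg_min G (\<lambda>t. t \<in> K) t' \<Longrightarrow> t' = t0"
  shows "t \<longlonglongrightarrow> t0"
proof (rule ccontr)
  assume "\<not> t \<longlonglongrightarrow> t0"
  then obtain U where U: "open U" "t0 \<in> U" "\<not> (\<forall>\<^sub>F n in sequentially. t n \<in> U)"
    by (auto simp: tendsto_def)
  then have "infinite {n. t n \<notin> U}"
    by (simp add: cofinite_eq_sequentially[symmetric] eventually_cofinite)
  then obtain r :: "nat \<Rightarrow> nat" where r: "strict_mono r" "\<And>n. t (r n) \<notin> U"
    using infinite_enumerate by blast
  have tK: "t n \<in> K" for n using t[of n] by (simp add: is_arg_min_def)
  obtain l q where l: "l \<in> K" "strict_mono q" "((\<lambda>n. t (r n)) \<circ> q) \<longlonglongrightarrow> l"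
    using seq_compactE[OF K, of "\<lambda>n. t (r n)"] tK by blast
  have rq: "strict_mono (\<lambda>n. r (q n))"
    using strict_mono_o[OF r(1) l(2)] by (simp add: o_def)
  have lim: "(\<lambda>n. F (r (q n)) (t (r (q n)))) \<longlonglongrightarrow> G l"
    using F[OF _ l(1) _ rq, of "\<lambda>n. t (r (q n))"] l(3) tK by (simp add: o_def)
  have "G l \<le> G s" if s: "s \<in> K" for s
  proof (rule LIMSEQ_le[OF lim])
    \<comment> \<open>Continuous convergence, applied to a constant sequence.\<close>
    show "(\<lambda>n. F (r (q n)) s) \<longlonglongrightarrow> G s"
      using F[OF _ s _ rq, of "\<lambda>_. s"] s by simp
    show "\<exists>N. \<forall>n\<ge>N. F (r (q n)) (t (r (q n))) \<le> F (r (q n)) s"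
      using t s by (auto simp: is_arg_min_def not_less)
  qed
  then have "l = t0"
    using l(1) by (intro uniq) (auto simp: is_arg_min_def not_less)
  moreover have "l \<in> - U"
    by (rule closed_sequentially[OF _ _ l(3)]) (use U r in auto)
  ultimately show False using U by simp
qed

text \<open>\<open>arg_min_on\<close> is a Hilbert choice, so it returns a minimizer once one
  exists.\<close>

lemma arg_min_on_is_arg_min:
  assumes "\<exists>!t. is_arg_min f (\<lambda>t. t \<in> S) t"
  shows "is_arg_min f (\<lambda>t. t \<in> S) (arg_min_on f S)"
  unfolding arg_min_on_def arg_min_def using assms by (rule someI_ex[OF ex1_implies_ex])

section \<open>Localization of the nonlocal gradient\<close>

text \<open>By the second moment formula, \<open>g\<close> is the whole-space nonlocal gradient of
  the linear function with gradient \<open>g\<close>. The increments of \<open>u\<close> and of this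
  function differ by at most \<open>e * norm (x - z)\<close> within distance \<open>d\<close>, and
  by at most \<open>(M + norm g) * norm (x - z)\<close> beyond it. Division by the distance leaves
  constants times the mass of \<open>r\<close>.\<close>

lemma nonlocal_gradient_error:
  fixes u :: "'a::euclidean_space \<Rightarrow> real"
  assumes \<Omega>: "open \<Omega>" and lip: "M-lipschitz_on \<Omega> u" and x: "x \<in> \<Omega>"
    and h: "\<And>w. r w = h (norm w)" and r0: "\<And>w. 0 \<le> r w"
    and r: "has_bochner_integral lebesgue r 1"
    and e: "e \<ge> 0" and sub: "cball x d \<subseteq> \<Omega>"
    and lin: "\<And>z. z \<in> cball x d \<Longrightarrow> \<bar>u x - u z - (x - z) \<bullet> g\<bar> \<le> e * norm (x - z)"
  shows "norm (nonlocal_gradient \<Omega> r u x - g)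
    \<le> DIM('a) * (e + (M + norm g) * (LINT w:{w. norm w > d}|lebesgue. r w))"
proof -
  have M: "M \<ge> 0" using lip by (rule lipschitz_on_nonneg)
  \<comment> \<open>\<open>N\<close> is the nonlocal integrand extended by 0 off \<Omega>,
    \<open>L\<close> its counterpart for the linear function in the variable
    \<open>w = x - z\<close>, and \<open>T\<close> the tail of \<open>r\<close>.\<close>
  define N where "N z = indicator \<Omega> z *\<^sub>R
    (((u x - u z) / norm (x - z) * r (x - z)) *\<^sub>R ((x - z) /\<^sub>R norm (x - z)))" for z
  define L where "L w = ((g \<bullet> w) / norm w * r w) *\<^sub>R (w /\<^sub>R norm w)" for w
  define T where "T w = indicator {w. norm w > d} w *\<^sub>R r w" for w
  note refl = measurable_lebesgue_reflect[of x] lebesgue_distr_reflect[of x]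
  have [measurable]: "r \<in> borel_measurable lebesgue" and ri: "integrable lebesgue r"
    using r by (auto simp: has_bochner_integral_iff)
  have [measurable]: "(\<lambda>x. x) \<in> borel_measurable (lebesgue :: 'a measure)"
    by (simp add: measurable_completion)
  have [measurable]: "(\<lambda>z. r (x - z)) \<in> borel_measurable lebesgue"
    by (rule measurable_compose[OF refl(1)]) measurable
  have "open {w::'a. norm w > d}"
    by (intro open_Collect_less continuous_intros)
  then have tail: "{w::'a. norm w > d} \<in> sets lebesgue"
    by simp
  have Ti: "integrable lebesgue T"
    unfolding T_def using ri tail by (rule integrable_mult_indicator[rotated])
  have [measurable]: "\<Omega> \<in> sets lebesgue" using \<Omega> by simp
  \<comment> \<open>Off \<Omega> nothing is known of \<open>u\<close>, so only its truncation is
    shown measurable; \<open>N_alt\<close> rewrites \<open>N\<close> in terms of it.\<close>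
  have "(\<lambda>z. indicator \<Omega> z *\<^sub>R u z) \<in> borel_measurable borel"
    using borel_measurable_continuous_on_indicator[OF _ lipschitz_on_continuous_on[OF lip]] \<Omega>
    by simp
  then have [measurable]: "(\<lambda>z. indicator \<Omega> z *\<^sub>R u z) \<in> borel_measurable lebesgue"
    by (intro measurable_completion) simp
  have N_alt: "N z = ((indicator \<Omega> z * u x - indicator \<Omega> z *\<^sub>R u z) / norm (x - z) * r (x - z))
      *\<^sub>R ((x - z) /\<^sub>R norm (x - z))" for z
    by (simp add: N_def indicator_def)
  have Nm: "N \<in> borel_measurable lebesgue"
    unfolding N_alt[abs_def] by measurable
  have L: "has_bochner_integral lebesgue L ((1 / DIM('a)) *\<^sub>R g)"
    unfolding L_def by (rule has_bochner_integral_radial_second_moment[OF h r])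
  have trans: "integrable lebesgue (\<lambda>z. f (x - z))" "(LINT z|lebesgue. f (x - z)) = (LINT z|lebesgue. f z)"
    if "integrable lebesgue f" for f :: "'a \<Rightarrow> 'b::{banach, second_countable_topology}"
  proof -
    show "integrable lebesgue (\<lambda>z. f (x - z))"
      using integrable_distr[OF refl(1), of f] that by (simp add: refl(2))
    show "(LINT z|lebesgue. f (x - z)) = (LINT z|lebesgue. f z)"
      using that by (intro lebesgue_integral_invariant refl) auto
  qed
  define B where "B w = e * r w + (M + norm g) * T w" for w
  have Bi: "integrable lebesgue B"
    unfolding B_def using ri Ti by simp
  have bound: "norm (N z - L (x - z)) \<le> B (x - z)" for z
  proof (cases "x = z")
    case True
    \<comment> \<open>Both integrands vanish by the convention for division by 0, and
      \<open>B\<close> is nonnegative.\<close>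
    then show ?thesis using e M r0 by (simp add: N_def L_def B_def T_def)
  next
    case False
    define w where "w = x - z"
    have w: "norm w > 0" using False by (simp add: w_def)
    \<comment> \<open>The difference of the two increments, that of \<open>u\<close> being counted
      as 0 off \<Omega>.\<close>
    define c where "c = indicator \<Omega> z * (u x - u z) - g \<bullet> w"
    have "N z - L w = (c / norm w * r w) *\<^sub>R (w /\<^sub>R norm w)"
    proof -
      have "N z = (indicator \<Omega> z * (u x - u z) / norm w * r w) *\<^sub>R (w /\<^sub>R norm w)"
        by (simp add: N_def w_def)
      then show ?thesis
        by (simp only: L_def c_def diff_divide_distrib left_diff_distrib scaleR_diff_left)
    qed
    then have eq: "norm (N z - L w) = \<bar>c\<bar> / norm w * r w"
      using w r0[of w] by (simp add: abs_mult divide_inverse)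
    have "\<bar>c\<bar> / norm w * r w \<le> B w"
    proof (cases "norm w > d")
      case True
      have "\<bar>indicator \<Omega> z * (u x - u z)\<bar> \<le> M * norm w"
        using lipschitz_onD[OF lip x, of z] M
        by (auto simp: indicator_def dist_norm w_def)
      moreover have "\<bar>g \<bullet> w\<bar> \<le> norm g * norm w" by (rule Cauchy_Schwarz_ineq2)
      ultimately have "\<bar>c\<bar> \<le> (M + norm g) * norm w"
        unfolding c_def by (simp add: algebra_simps)
      then have "\<bar>c\<bar> / norm w \<le> M + norm g" using w by (simp add: divide_le_eq)
      then have "\<bar>c\<bar> / norm w * r w \<le> (M + norm g) * r w"
        using r0 by (rule mult_right_mono)
      also have "\<dots> \<le> B w"
        using True e r0[of w] by (simp add: B_def T_def)
      finally show ?thesis .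
    next
      case False
      then have z: "z \<in> cball x d" by (simp add: dist_norm w_def)
      then have "z \<in> \<Omega>" using sub by blast
      then have "\<bar>c\<bar> \<le> e * norm w"
        using lin[OF z] by (simp add: c_def w_def inner_commute)
      then have "\<bar>c\<bar> / norm w \<le> e" using w by (simp add: divide_le_eq)
      then have "\<bar>c\<bar> / norm w * r w \<le> e * r w"
        using r0 by (rule mult_right_mono)
      also have "\<dots> = B w" using False by (simp add: B_def T_def)
      finally show ?thesis .
    qed
    then show ?thesis using eq by (simp add: w_def)
  qed
  have Li: "integrable lebesgue (\<lambda>z. L (x - z))"
    using L by (intro trans) (simp add: has_bochner_integral_iff)
  \<comment> \<open>The pointwise bound also yields integrability of \<open>N\<close>, as the sum of
    this difference and the reflected \<open>L\<close>.\<close>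
  have diff_i: "integrable lebesgue (\<lambda>z. N z - L (x - z))"
  proof (rule Bochner_Integration.integrable_bound[OF trans(1)[OF Bi]])
    show "(\<lambda>z. N z - L (x - z)) \<in> borel_measurable lebesgue"
      using Nm Li by (intro borel_measurable_diff) auto
    show "AE z in lebesgue. norm (N z - L (x - z)) \<le> norm (B (x - z))"
      using bound order_trans[OF _ abs_ge_self] by (intro AE_I2) auto
  qed
  have "integrable lebesgue N"
    using Bochner_Integration.integrable_add[OF diff_i Li] by simp
  then have "(LINT z|lebesgue. N z - L (x - z))
      = (LINT z|lebesgue. N z) - (LINT z|lebesgue. L (x - z))"
    using Li by (rule Bochner_Integration.integral_diff)
  also have "(LINT z|lebesgue. L (x - z)) = (1 / DIM('a)) *\<^sub>R g"
    using L trans(2)[of L] by (simp add: has_bochner_integral_iff)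
  \<comment> \<open>The factor \<open>1 / DIM('a)\<close> of the moment cancels the dimension factor
    of the nonlocal gradient.\<close>
  finally have "nonlocal_gradient \<Omega> r u x - g
      = real DIM('a) *\<^sub>R (LINT z|lebesgue. N z - L (x - z))"
    by (simp add: nonlocal_gradient_def set_lebesgue_integral_def N_def scaleR_diff_right)
  then have "norm (nonlocal_gradient \<Omega> r u x - g)
      = real DIM('a) * norm (LINT z|lebesgue. N z - L (x - z))" by simp
  also have "\<dots> \<le> real DIM('a) * (LINT z|lebesgue. B (x - z))"
    using Bochner_Integration.integral_norm_bound_integral[OF diff_i trans(1)[OF Bi]] bound
    by (intro mult_left_mono) auto
  also have "(LINT z|lebesgue. B (x - z)) = (LINT w|lebesgue. B w)"
    by (rule trans(2)[OF Bi])
  also have "\<dots> = e + (M + norm g) * (LINT w|lebesgue. T w)"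
    unfolding B_def using ri Ti r by (simp add: has_bochner_integral_iff)
  finally show ?thesis
    by (simp add: T_def set_lebesgue_integral_def)
qed

text \<open>The error bound is used at the moving point \<open>Y n\<close> with the linear part
  frozen at \<open>y\<close>. One radius serves all large \<open>n\<close>, so the local error is
  fixed first and the tail mass then tends to 0.\<close>

lemma nonlocal_gradient_tendsto:
  fixes u :: "'a::euclidean_space \<Rightarrow> real"
  assumes \<Omega>: "open \<Omega>" and \<rho>: "radial_mollifiers \<rho>" and lip: "M-lipschitz_on \<Omega> u"
    and u: "Ck_on (Suc k) u \<Omega>" and y: "y \<in> \<Omega>" and Y: "Y \<longlonglongrightarrow> y"
  shows "(\<lambda>n. nonlocal_gradient \<Omega> (\<rho> n) u (Y n)) \<longlonglongrightarrow> gradient u y"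
proof (rule tendstoI)
  fix \<epsilon> :: real assume \<epsilon>: "\<epsilon> > 0"
  define g where "g = gradient u y"
  \<comment> \<open>The local error then contributes \<open>\<epsilon> / 2\<close>, which leaves
    room for the tail.\<close>
  define e where "e = \<epsilon> / (2 * DIM('a))"
  have e: "e > 0" using \<epsilon> by (simp add: e_def)
  obtain d where d: "d > 0" "ball y d \<subseteq> \<Omega>" and
    lin: "\<And>a b. a \<in> ball y d \<Longrightarrow> b \<in> ball y d \<Longrightarrow> \<bar>u b - u a - (b - a) \<bullet> g\<bar> \<le> e * norm (b - a)"
    using C1_linearization[OF \<Omega> u y e] unfolding g_def by blast
  \<comment> \<open>A closed ball of radius \<open>d / 3\<close> about a point within
    \<open>d / 3\<close> of \<open>y\<close> stays inside \<open>ball y d\<close>.\<close>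
  define \<tau> where "\<tau> n = (LINT w:{w. norm w > d / 3}|lebesgue. \<rho> n w)" for n
  have "\<forall>\<delta>>0. (\<lambda>n. LINT w:{w. norm w > \<delta>}|lebesgue. \<rho> n w) \<longlonglongrightarrow> 0"
    using \<rho> unfolding radial_mollifiers_def by (rule conjunct2)
  then have "\<tau> \<longlonglongrightarrow> 0"
    unfolding \<tau>_def using d(1) by (elim allE[where x = "d / 3"] impE) simp_all
  then have "(\<lambda>n. DIM('a) * (e + (M + norm g) * \<tau> n)) \<longlonglongrightarrow> DIM('a) * (e + (M + norm g) * 0)"
    by (intro tendsto_intros)
  moreover have "DIM('a) * (e + (M + norm g) * 0) < \<epsilon>"
    using \<epsilon> by (simp add: e_def)
  ultimately have "\<forall>\<^sub>F n in sequentially. DIM('a) * (e + (M + norm g) * \<tau> n) < \<epsilon>"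
    by (rule order_tendstoD)
  moreover have "\<forall>\<^sub>F n in sequentially. dist (Y n) y < d / 3"
    using Y d(1) by (intro tendstoD) auto
  \<comment> \<open>Radial symmetry, positivity and unit mass are given from index 1 on.\<close>
  moreover have "\<forall>\<^sub>F n in sequentially. n \<ge> 1"
    by (rule eventually_ge_at_top)
  ultimately show "\<forall>\<^sub>F n in sequentially.
    dist (nonlocal_gradient \<Omega> (\<rho> n) u (Y n)) (gradient u y) < \<epsilon>"
  proof eventually_elim
    case (elim n)
    have sub: "cball (Y n) (d / 3) \<subseteq> ball y d"
    proof
      fix z assume "z \<in> cball (Y n) (d / 3)"
      then show "z \<in> ball y d"
        using elim(2) dist_triangle[of y z "Y n"] d(1) by (simp add: dist_commute)
    qed
    have Yn: "Y n \<in> ball y d" using elim(2) d(1) by (simp add: dist_commute)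
    from \<rho> elim(3) obtain h where h: "\<And>w. \<rho> n w = h (norm w)" "\<And>w. 0 \<le> \<rho> n w"
      "has_bochner_integral lebesgue (\<rho> n) 1"
      unfolding radial_mollifiers_def by blast
    have "norm (nonlocal_gradient \<Omega> (\<rho> n) u (Y n) - g) \<le> DIM('a) * (e + (M + norm g) * \<tau> n)"
      unfolding \<tau>_def
    proof (rule nonlocal_gradient_error[OF \<Omega> lip _ h])
      show "\<bar>u (Y n) - u z - (Y n - z) \<bullet> g\<bar> \<le> e * norm (Y n - z)"
        if "z \<in> cball (Y n) (d / 3)" for z
        using lin Yn sub that by blast
    qed (use e Yn sub d in auto)
    then show ?case using elim(1) by (simp add: dist_norm g_def)
  qed
qed

section \<open>Convergence of step sizes and iterates\<close>

theorem theorem2p6: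
  fixes \<Omega> :: "'a::euclidean_space set"
    and \<rho> :: "nat \<Rightarrow> 'a \<Rightarrow> real"
    and u :: "'a \<Rightarrow> real"
    and M A :: real
    and x0 :: 'a
    and x :: "nat \<Rightarrow> 'a" and \<alpha> :: "nat \<Rightarrow> real"
    and xn :: "nat \<Rightarrow> nat \<Rightarrow> 'a" and \<alpha>n :: "nat \<Rightarrow> nat \<Rightarrow> real"
  assumes "open \<Omega>" and "bounded \<Omega>" and "connected \<Omega>" and "simply_connected \<Omega>"
    and "compact (frontier \<Omega>)" and "smooth_boundary \<Omega>"
    and "radial_mollifiers \<rho>"
    and "Ck_on 2 u \<Omega>" and "M-lipschitz_on \<Omega> u"
    and "A > 0" and "x0 \<in> \<Omega>"
    and "exact_line_search_descent u A (gradient u) x0 x \<alpha>"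
    and "\<And>n. n \<ge> 1 \<Longrightarrow>
           exact_line_search_descent u A (nonlocal_gradient \<Omega> (\<rho> n) u) x0 (xn n) (\<alpha>n n)"
    and "\<And>k t. t \<in> {0..A} \<Longrightarrow> x k - t *\<^sub>R gradient u (x k) \<in> \<Omega>"
    and "\<And>n k t. n \<ge> 1 \<Longrightarrow> t \<in> {0..A} \<Longrightarrow>
           xn n k - t *\<^sub>R nonlocal_gradient \<Omega> (\<rho> n) u (xn n k) \<in> \<Omega>"
    and "\<And>k. unique_line_minimizer u A (gradient u) (x k)"
    and "\<And>n k. n \<ge> 1 \<Longrightarrow>
           unique_line_minimizer u A (nonlocal_gradient \<Omega> (\<rho> n) u) (xn n k)"
  shows "\<forall>k. (\<exists>r :: nat \<Rightarrow> nat. strict_mono r \<and> (\<forall>m. r m \<ge> 1) \<and>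
                 (\<lambda>m. \<alpha>n (r m) k) \<longlonglongrightarrow> \<alpha> k) \<and>
             (\<exists>s :: nat \<Rightarrow> nat. strict_mono s \<and> (\<forall>m. s m \<ge> 1) \<and>
                 (\<lambda>m. xn (s m) k) \<longlonglongrightarrow> x k)"
proof -
  have u1: "Ck_on (Suc 1) u \<Omega>" using assms(8) by (simp add: numeral_2_eq_2)
  have isCont_u: "isCont u y" if "y \<in> \<Omega>" for y
    using lipschitz_on_continuous_on[OF assms(9)] assms(1) that
    by (simp add: continuous_on_eq_continuous_at)
  \<comment> \<open>The iterate is the point \<open>t = 0\<close> of its own search segment.\<close>
  have x\<Omega>: "x k \<in> \<Omega>" for k
    using assms(14)[of 0 k] \<open>A > 0\<close> by simp
  define G where "G n k = nonlocal_gradient \<Omega> (\<rho> n) u (xn n k)" for n k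
  have step: "x (Suc k) = x k - \<alpha> k *\<^sub>R gradient u (x k)" for k
    using assms(12) by (simp add: exact_line_search_descent_def)
  have stepn: "xn n (Suc k) = xn n k - \<alpha>n n k *\<^sub>R G n k" if "n \<ge> 1" for n k
    using assms(13)[OF that] by (simp add: exact_line_search_descent_def G_def)
  have \<alpha>: "\<alpha> k = arg_min_on (\<lambda>t. u (x k - t *\<^sub>R gradient u (x k))) {0..A}" for k
    using assms(12) unfolding exact_line_search_descent_def by blast
  have \<alpha>n: "is_arg_min (\<lambda>t. u (xn n k - t *\<^sub>R G n k)) (\<lambda>t. t \<in> {0..A}) (\<alpha>n n k)" if "n \<ge> 1" for n k
  proof -
    have "\<alpha>n n k = arg_min_on (\<lambda>t. u (xn n k - t *\<^sub>R G n k)) {0..A}"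
      using assms(13)[OF that] unfolding exact_line_search_descent_def G_def by blast
    then show ?thesis
      using arg_min_on_is_arg_min[OF assms(17)[OF that, of k, unfolded unique_line_minimizer_def]]
      by (simp only: G_def)
  qed
  have G_lim: "(\<lambda>n. G n k) \<longlonglongrightarrow> gradient u (x k)" if "(\<lambda>n. xn n k) \<longlonglongrightarrow> x k" for k
    unfolding G_def
    by (rule nonlocal_gradient_tendsto[OF assms(1,7,9) u1 x\<Omega> that])
  \<comment> \<open>The shift by one keeps every index at least 1, where \<open>\<alpha>n\<close> is
    known to be a minimizer.\<close>
  have \<alpha>_lim: "(\<lambda>n. \<alpha>n (Suc n) k) \<longlonglongrightarrow> \<alpha> k" if lim: "(\<lambda>n. xn n k) \<longlonglongrightarrow> x k" for k
  proof (rule arg_min_tendsto[where K = "{0..A}"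
        and F = "\<lambda>n t. u (xn (Suc n) k - t *\<^sub>R G (Suc n) k)"
        and G = "\<lambda>t. u (x k - t *\<^sub>R gradient u (x k))"])
    show "seq_compact {0..A}" by (simp add: compact_imp_seq_compact)
    fix s :: "nat \<Rightarrow> real" and t0 and r :: "nat \<Rightarrow> nat"
    assume t0: "t0 \<in> {0..A}" and s: "s \<longlonglongrightarrow> t0" and r: "strict_mono r"
    have sub: "filterlim (\<lambda>n. Suc (r n)) sequentially sequentially"
      using r by (intro filterlim_subseq) (simp add: strict_mono_def)
    \<comment> \<open>Continuous convergence of the line-search functions: the arguments converge to
      a point of \<Omega>, where \<open>u\<close> is continuous.\<close>
    have "(\<lambda>n. xn (Suc (r n)) k - s n *\<^sub>R G (Suc (r n)) k)
        \<longlonglongrightarrow> x k - t0 *\<^sub>R gradient u (x k)"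
      using s by (intro tendsto_intros filterlim_compose[OF lim sub]
          filterlim_compose[OF G_lim[OF lim] sub])
    then show "(\<lambda>n. u (xn (Suc (r n)) k - s n *\<^sub>R G (Suc (r n)) k))
        \<longlonglongrightarrow> u (x k - t0 *\<^sub>R gradient u (x k))"
      by (rule isCont_tendsto_compose[OF isCont_u[OF assms(14)[OF t0]]])
  next
    show "is_arg_min (\<lambda>t. u (xn (Suc n) k - t *\<^sub>R G (Suc n) k)) (\<lambda>t. t \<in> {0..A}) (\<alpha>n (Suc n) k)" for n
      by (rule \<alpha>n) simp
  next
    fix t' assume t': "is_arg_min (\<lambda>t. u (x k - t *\<^sub>R gradient u (x k))) (\<lambda>t. t \<in> {0..A}) t'"
    note ex1 = assms(16)[of k, unfolded unique_line_minimizer_def]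
    show "t' = \<alpha> k"
      unfolding \<alpha> using ex1 t' arg_min_on_is_arg_min[OF ex1] by blast
  qed
  \<comment> \<open>Convergence of the iterates at stage \<open>k\<close> gives that of gradients
    and step sizes, hence of the iterates at stage \<open>Suc k\<close>.\<close>
  have x_lim: "(\<lambda>n. xn n k) \<longlonglongrightarrow> x k" for k
  proof (induction k)
    case 0
    \<comment> \<open>The hypotheses do not describe \<open>xn 0\<close>, so the limit is taken
      along \<open>Suc n\<close> first.\<close>
    have "xn n 0 = x 0" if "n \<ge> 1" for n
      using assms(12) assms(13)[OF that] by (simp add: exact_line_search_descent_def)
    then have "(\<lambda>n. xn (Suc n) 0) \<longlonglongrightarrow> x 0" by simp
    then show ?case by (rule LIMSEQ_imp_Suc)
  next
    case (Suc k)
    have "(\<lambda>n. xn (Suc n) k - \<alpha>n (Suc n) k *\<^sub>R G (Suc n) k)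
        \<longlonglongrightarrow> x k - \<alpha> k *\<^sub>R gradient u (x k)"
      by (intro tendsto_intros \<alpha>_lim LIMSEQ_Suc[OF Suc] LIMSEQ_Suc[OF G_lim] Suc)
    then have "(\<lambda>n. xn (Suc n) (Suc k)) \<longlonglongrightarrow> x (Suc k)" by (simp add: step stepn)
    then show ?case by (rule LIMSEQ_imp_Suc)
  qed
  \<comment> \<open>As the full sequences converge, the indices 1, 2, 3, ... serve as both
    subsequences.\<close>
  have "strict_mono Suc" by (simp add: strict_mono_def)
  then show ?thesis
    using \<alpha>_lim[OF x_lim] LIMSEQ_Suc[OF x_lim] by (intro allI conjI exI[of _ Suc]) auto
qed

end
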